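(* Let $Y$ be a real random variable whose moment generating function $E[e^{tY}]$ exists for $|t|<\rho$ for some $\rho>0$. Let $(Y_j)_{j\ge 1}$ be a sequence of mutually independent copies of $Y$, and let $S_0=0$, $S_k=Y_1+\cdots+Y_k$ for $k\ge 1$. For every integer $n\ge 0$ and every real $x$, $$\sum_{m=0}^{n}\binom{n}{m}\phi_{m}^{Y}(1-x)E_{n-m}^{Y}=2e^{x-1}\sum_{m=0}^{\infty}\frac{D_{m}(x)}{m!}(-1)^{m}E[S_{m}^{n}].$$
   Context: The derangement polynomials $D_n(x)$ are defined by $$\frac{e^{xt}}{1-t}e^{-t}=\sum_{n=0}^{\infty}D_{n}(x)\frac{t^{n}}{n!}.$$ The probabilistic Stirling numbers of the second kind ${n \brace k}_Y$ associated with $Y$ are defined for $n\ge k\ge 0$ by $$\frac{1}{k!}\big(E[e^{tY}]-1\big)^{k}=\sum_{n=k}^{\infty}{n \brace k}_{Y}\frac{t^{n}}{n!},$$ and the probabilistic Bell polynomials associated with $Y$ are $\phi_{n}^{Y}(x)=\sum_{k=0}^{n}{n \brace k}_{Y}x^{k}$, $n\ge 0$. The probabilistic Euler numbers $E_n^Y$ are defined by $$\frac{2}{E[e^{tY}]+1}=\sum_{n=0}^{\infty}E_{n}^{Y}\frac{t^{n}}{n!}.$$ Convention: $0^0=1$.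
   Formalization: The infinite series on the right is read as an Abel sum (limit as r→1- of the series with factor r^m), since it diverges in the ordinary sense, e.g. for n=0, where D_m(x)/m! tends to e^{x-1}≠0; wherever it converges, Abel's theorem gives the stated identity. *)

theory Defs
  imports "HOL-Probability.Probability"
begin

text \<open>
  The coefficients \<open>a\<^sub>n\<close> in \<open>f t = (\<Sum>n. a\<^sub>n * t ^ n / n!)\<close>, the identity holding for all \<open>t\<close> in a
  neighbourhood of \<open>0\<close>.  They are well defined by the uniqueness lemma below; for an \<open>f\<close> that has
  no such expansion, the value is unspecified.
\<close>

definition egf_coeff :: "(real \<Rightarrow> real) \<Rightarrow> nat \<Rightarrow> real" where
  "egf_coeff f n = fact n * fps_nth (THE F. f has_fps_expansion F) n"

lemma has_fps_expansion_real_unique: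
  fixes f :: "real \<Rightarrow> real"
  assumes "f has_fps_expansion F" "f has_fps_expansion G"
  shows "F = G"
proof (rule ccontr)
  assume "F \<noteq> G"
  define H where "H = F - G"
  define d where "d = subdegree H"
  define K where "K = fps_shift d H"
  have "H \<noteq> 0"
    using \<open>F \<noteq> G\<close> by (simp add: H_def)
  have "(\<lambda>t. f t - f t) has_fps_expansion H"
    unfolding H_def using assms by (intro has_fps_expansion_diff)
  then have radius: "fps_conv_radius H > 0" and zero: "\<forall>\<^sub>F t in nhds 0. eval_fps H t = 0"
    by (simp_all add: has_fps_expansion_def)
  have "fps_conv_radius K > 0"
    using radius by (simp add: K_def)
  then have "isCont (eval_fps K) 0"
    by (intro continuous_eval_fps) (simp add: zero_ereal_def)
  then have lim: "(eval_fps K \<longlongrightarrow> fps_nth K 0) (at 0)"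
    by (simp add: isCont_def eval_fps_at_0)
  have "\<forall>\<^sub>F t in nhds (0 :: real). t \<in> eball 0 (fps_conv_radius H)"
    using radius by (intro eventually_nhds_in_open) (auto simp: zero_ereal_def)
  with zero have "\<forall>\<^sub>F t in nhds 0. t \<noteq> 0 \<longrightarrow> eval_fps K t = 0"
    by eventually_elim (auto simp: K_def d_def eval_fps_shift)
  then have "\<forall>\<^sub>F t in at 0. eval_fps K t = 0"
    by (simp add: eventually_at_filter)
  then have "(eval_fps K \<longlongrightarrow> 0) (at 0)"
    by (rule tendsto_eventually)
  with lim have "fps_nth K 0 = 0"
    by (intro tendsto_unique[of "at (0 :: real)"]) auto
  then show False
    using \<open>H \<noteq> 0\<close> by (simp add: K_def d_def)
qed

lemma egf_coeff_eq:
  assumes "f has_fps_expansion F"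
  shows "egf_coeff f n = fact n * fps_nth F n"
proof -
  have "(THE G. f has_fps_expansion G) = F"
    using assms has_fps_expansion_real_unique by blast
  then show ?thesis
    by (simp add: egf_coeff_def)
qed

definition derangement_poly :: "nat \<Rightarrow> real \<Rightarrow> real" where
  "derangement_poly n x = egf_coeff (\<lambda>t. exp (x * t) / (1 - t) * exp (- t)) n"

definition mgf :: "'a measure \<Rightarrow> ('a \<Rightarrow> real) \<Rightarrow> real \<Rightarrow> real" where
  "mgf M Y t = (\<integral>\<omega>. exp (t * Y \<omega>) \<partial>M)"

definition prob_stirling2 :: "'a measure \<Rightarrow> ('a \<Rightarrow> real) \<Rightarrow> nat \<Rightarrow> nat \<Rightarrow> real" where
  "prob_stirling2 M Y n k = egf_coeff (\<lambda>t. 1 / fact k * (mgf M Y t - 1) ^ k) n"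

definition prob_bell :: "'a measure \<Rightarrow> ('a \<Rightarrow> real) \<Rightarrow> nat \<Rightarrow> real \<Rightarrow> real" where
  "prob_bell M Y n x = (\<Sum>k=0..n. prob_stirling2 M Y n k * x ^ k)"

definition prob_euler :: "'a measure \<Rightarrow> ('a \<Rightarrow> real) \<Rightarrow> nat \<Rightarrow> real" where
  "prob_euler M Y n = egf_coeff (\<lambda>t. 2 / (mgf M Y t + 1)) n"

text \<open>
  Abel summation: the series \<open>\<Sum>m. f m * r ^ m\<close> converges for \<open>0 < r < 1\<close>, and its sum tends to \<open>s\<close>
  as \<open>r\<close> tends to \<open>1\<close> from below.  By Abel's theorem, a series that converges to \<open>s\<close> in the ordinary
  sense is also Abel summable to \<open>s\<close>.

  The series \<open>\<Sum>m. D\<^sub>m(x) / m! * (-1) ^ m * E[S\<^sub>m ^ n]\<close> has to be read in this sense, because in general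
  its partial sums diverge: \<open>D\<^sub>m(x) / m! = (\<Sum>k\<le>m. (x - 1) ^ k / k!)\<close> tends to \<open>exp (x - 1) \<noteq> 0\<close>, so
  that for \<open>n = 0\<close>, where \<open>E[S\<^sub>m ^ n] = 1\<close>, the terms do not even tend to \<open>0\<close>.
\<close>

definition abel_sums :: "(nat \<Rightarrow> real) \<Rightarrow> real \<Rightarrow> bool"  (infixr "abel'_sums" 80) where
  "f abel_sums s \<longleftrightarrow>
     (\<forall>r. 0 < r \<and> r < 1 \<longrightarrow> summable (\<lambda>m. f m * r ^ m)) \<and>
     ((\<lambda>r. \<Sum>m. f m * r ^ m) \<longlongrightarrow> s) (at_left 1)"

end

theory Submission
  imports Defs
begin

text \<open>
  Write \<open>y = 1 - x\<close>, let \<open>F\<close> be the power series of the moment generating function of \<open>Y\<close>, and put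
  \<open>H = F - 1\<close>, a series without constant term.

  Formally, both sides have the exponential generating function \<open>2 e^(y H) / (2 + H)\<close>.  On the left
  it is the product of \<open>e^(y H)\<close>, which generates the Bell polynomials, and \<open>2 / (F + 1)\<close>, which
  generates the Euler numbers.  On the right, \<open>E[S\<^sub>m ^ n]\<close> is \<open>n!\<close> times the \<open>n\<close>-th coefficient of
  \<open>F ^ m\<close>, and \<open>D\<^sub>m(x) / m! * (-1) ^ m\<close> is the \<open>m\<close>-th coefficient of \<open>G(u) = e^(y u) / (1 + u)\<close>, so
  that one expects the series to be governed by \<open>G(F)\<close>.  But \<open>F\<close> has constant term \<open>1\<close>, which lies
  on the circle of convergence of \<open>G\<close>; so \<open>G(F)\<close> is not a composition of formal power series, and
  the sum is only an Abel sum.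

  To make this rigorous for a fixed \<open>n\<close>, expand \<open>F ^ m = (1 + H) ^ m\<close> binomially.  Only the powers
  \<open>H ^ k\<close> with \<open>k \<le> n\<close> contribute to the \<open>n\<close>-th coefficient, so the series splits into finitely many
  series \<open>P\<^sub>k(r) = (\<Sum>m. G\<^sub>m * (m choose k) * r ^ m)\<close>.  The recurrence \<open>G\<^sub>m\<^sub>+\<^sub>1 + G\<^sub>m = y ^ (m+1) / (m+1)!\<close>
  turns into
  \<open>(1 + r) P\<^sub>k(r) + r P\<^sub>k\<^sub>-\<^sub>1(r) = (y r) ^ k / k! * e^(y r)\<close>
  (\<open>signed_derangement_binomial_series\<close>).  By induction on \<open>k\<close> this forces \<open>P\<^sub>k(r)\<close> to converge as
  \<open>r\<close> tends to \<open>1\<close>, and the limits are the coefficients of \<open>e^y * e^(y u) / (2 + u)\<close>, the Taylor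
  series of \<open>G\<close> at \<open>1\<close> (\<open>signed_derangement_binomial_abel_limit\<close>).  Substituting \<open>H\<close> into that
  series, which is legitimate formally, gives \<open>e^y / 2\<close> times the generating function of the left
  side (\<open>bell_euler_convolution\<close>).
\<close>

section \<open>Moments and the moment generating function\<close>

text \<open>
  The exponential series may be integrated term by term: its partial sums at \<open>t X\<close> are dominated
  by \<open>exp \<bar>t X\<bar> \<le> exp (t X) + exp (- t X)\<close>, which is integrable.
\<close>

lemma mgf_has_fps_expansion:
  fixes M :: "'a measure" and X :: "'a \<Rightarrow> real"
  assumes [measurable]: "X \<in> borel_measurable M"
    and "\<delta> > 0"
    and int: "\<And>t. \<bar>t\<bar> < \<delta> \<Longrightarrow> integrable M (\<lambda>\<omega>. exp (t * X \<omega>))"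
  shows "mgf M X has_fps_expansion Abs_fps (\<lambda>n. (\<integral>\<omega>. X \<omega> ^ n \<partial>M) / fact n)"
proof (rule has_fps_expansionI)
  have "\<forall>\<^sub>F t in nhds (0::real). \<bar>t\<bar> < \<delta>"
    using eventually_nhds_in_open[of "ball 0 \<delta>" "0::real"] \<open>\<delta> > 0\<close> by simp
  moreover have "(\<lambda>n. fps_nth (Abs_fps (\<lambda>n. (\<integral>\<omega>. X \<omega> ^ n \<partial>M) / fact n)) n * t ^ n) sums mgf M X t"
    if t: "\<bar>t\<bar> < \<delta>" for t
  proof -
    define w where "w = (\<lambda>\<omega>. exp (t * X \<omega>) + exp (- t * X \<omega>))"
    have w: "integrable M w"
      unfolding w_def using int[of t] int[of "-t"] t by (intro Bochner_Integration.integrable_add) auto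
    have partial_bound: "(\<Sum>n<N. \<bar>t * X \<omega>\<bar> ^ n / fact n) \<le> w \<omega>" for N \<omega>
    proof -
      have "(\<Sum>n<N. \<bar>t * X \<omega>\<bar> ^ n / fact n) \<le> exp \<bar>t * X \<omega>\<bar>"
        unfolding exp_def using summable_exp[of "\<bar>t * X \<omega>\<bar>"]
        by (intro sum_le_suminf[THEN order_trans])
           (auto simp: scaleR_conv_of_real field_simps)
      also have "\<dots> \<le> w \<omega>"
        by (cases "t * X \<omega> \<ge> 0") (auto simp: w_def)
      finally show ?thesis .
    qed
    have term_int: "integrable M (\<lambda>\<omega>. (t * X \<omega>) ^ n / fact n)" for n
    proof (rule Bochner_Integration.integrable_bound[OF w])
      show "AE \<omega> in M. norm ((t * X \<omega>) ^ n / fact n) \<le> norm (w \<omega>)"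
      proof (rule AE_I2)
        fix \<omega>
        have "\<bar>t * X \<omega>\<bar> ^ n / fact n \<le> (\<Sum>k<Suc n. \<bar>t * X \<omega>\<bar> ^ k / fact k)"
          by (rule member_le_sum) auto
        also have "\<dots> \<le> w \<omega>" by (rule partial_bound)
        finally show "norm ((t * X \<omega>) ^ n / fact n) \<le> norm (w \<omega>)"
          by (simp add: power_abs)
      qed
    qed simp
    have "(\<lambda>N. \<integral>\<omega>. (\<Sum>n<N. (t * X \<omega>) ^ n / fact n) \<partial>M) \<longlonglongrightarrow> (\<integral>\<omega>. exp (t * X \<omega>) \<partial>M)"
    proof (rule integral_dominated_convergence[where w = w])
      show "AE \<omega> in M. (\<lambda>N. \<Sum>n<N. (t * X \<omega>) ^ n / fact n) \<longlonglongrightarrow> exp (t * X \<omega>)"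
        using exp_converges[of "t * X _"]
        by (intro AE_I2) (simp add: sums_def scaleR_conv_of_real field_simps)
      show "AE \<omega> in M. norm (\<Sum>n<N. (t * X \<omega>) ^ n / fact n) \<le> w \<omega>" for N
      proof (rule AE_I2)
        fix \<omega>
        have "norm (\<Sum>n<N. (t * X \<omega>) ^ n / fact n) \<le> (\<Sum>n<N. norm ((t * X \<omega>) ^ n / fact n))"
          by (rule norm_sum)
        also have "\<dots> = (\<Sum>n<N. \<bar>t * X \<omega>\<bar> ^ n / fact n)"
          by (simp add: power_abs)
        finally show "norm (\<Sum>n<N. (t * X \<omega>) ^ n / fact n) \<le> w \<omega>"
          using partial_bound[where N = N and \<omega> = \<omega>] by linarith
      qed
    qed (use w in auto)
    moreover have "(\<integral>\<omega>. (\<Sum>n<N. (t * X \<omega>) ^ n / fact n) \<partial>M) =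
        (\<Sum>n<N. (\<integral>\<omega>. X \<omega> ^ n \<partial>M) / fact n * t ^ n)" for N
    proof -
      have "(\<integral>\<omega>. (t * X \<omega>) ^ n / fact n \<partial>M) = (\<integral>\<omega>. X \<omega> ^ n \<partial>M) / fact n * t ^ n" for n
        by (simp add: power_mult_distrib)
      then show ?thesis
        using term_int by (subst Bochner_Integration.integral_sum) auto
    qed
    ultimately show ?thesis
      by (simp add: sums_def mgf_def)
  qed
  ultimately show "\<forall>\<^sub>F t in nhds 0.
      (\<lambda>n. fps_nth (Abs_fps (\<lambda>n. (\<integral>\<omega>. X \<omega> ^ n \<partial>M) / fact n)) n * t ^ n) sums mgf M X t"
    by (rule eventually_mono)
qed

lemma has_fps_expansion_pow:
  fixes f :: "real \<Rightarrow> real"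
  assumes "f has_fps_expansion F"
  shows "(\<lambda>t. f t ^ k) has_fps_expansion F ^ k"
  by (induction k) (auto intro!: has_fps_expansion_mult assms)

lemma (in prob_space) mgf_sum_iid:
  fixes Y :: "'a \<Rightarrow> real" and Ys :: "nat \<Rightarrow> 'a \<Rightarrow> real"
  assumes Y [measurable]: "Y \<in> borel_measurable M"
    and indep: "indep_vars (\<lambda>_. borel) Ys {1..}"
    and distr: "\<And>j. j \<ge> 1 \<Longrightarrow> distr M borel (Ys j) = distr M borel Y"
    and int: "integrable M (\<lambda>\<omega>. exp (t * Y \<omega>))"
  shows "integrable M (\<lambda>\<omega>. exp (t * (\<Sum>j=1..m. Ys j \<omega>)))"
    and "mgf M (\<lambda>\<omega>. \<Sum>j=1..m. Ys j \<omega>) t = mgf M Y t ^ m"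
proof -
  have meas [measurable]: "Ys j \<in> borel_measurable M" if "j \<ge> 1" for j
    using indep that unfolding indep_vars_def2 by auto
  have int_j: "integrable M (\<lambda>\<omega>. exp (t * Ys j \<omega>))" if "j \<ge> 1" for j
    using int distr[OF that] integrable_distr_eq[of "Ys j" M borel "\<lambda>y. exp (t * y)"]
      integrable_distr_eq[of Y M borel "\<lambda>y. exp (t * y)"] meas[OF that] by simp
  have mgf_j: "(\<integral>\<omega>. exp (t * Ys j \<omega>) \<partial>M) = mgf M Y t" if "j \<ge> 1" for j
    unfolding mgf_def
    using distr[OF that] integral_distr[of "Ys j" M borel "\<lambda>y. exp (t * y)"]
      integral_distr[of Y M borel "\<lambda>y. exp (t * y)"] meas[OF that] by simp
  have ind: "indep_vars (\<lambda>_. borel) (\<lambda>j \<omega>. exp (t * Ys j \<omega>)) {1..m}"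
    by (rule indep_vars_compose2[where X = Ys and M' = "\<lambda>_. borel"])
      (auto intro: indep_vars_subset[OF indep])
  have eq: "exp (t * (\<Sum>j=1..m. Ys j \<omega>)) = (\<Prod>j=1..m. exp (t * Ys j \<omega>))" for \<omega>
    by (simp add: sum_distrib_left exp_sum)
  show "integrable M (\<lambda>\<omega>. exp (t * (\<Sum>j=1..m. Ys j \<omega>)))"
    unfolding eq using ind int_j by (intro indep_vars_integrable) auto
  have "(\<integral>\<omega>. (\<Prod>j=1..m. exp (t * Ys j \<omega>)) \<partial>M) = (\<Prod>j=1..m. \<integral>\<omega>. exp (t * Ys j \<omega>) \<partial>M)"
    using ind int_j by (intro indep_vars_lebesgue_integral) auto
  then show "mgf M (\<lambda>\<omega>. \<Sum>j=1..m. Ys j \<omega>) t = mgf M Y t ^ m"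
    unfolding mgf_def eq using mgf_j by (simp add: mgf_def)
qed

text \<open>
  The moments of \<open>S\<^sub>m\<close> can be read off the power series of its moment generating function, which by
  independence is the \<open>m\<close>-th power of that of \<open>Y\<close>.
\<close>

lemma (in prob_space) moment_sum_iid:
  fixes Y :: "'a \<Rightarrow> real" and Ys :: "nat \<Rightarrow> 'a \<Rightarrow> real"
  assumes Y: "Y \<in> borel_measurable M"
    and "\<rho> > 0"
    and int: "\<And>t. \<bar>t\<bar> < \<rho> \<Longrightarrow> integrable M (\<lambda>\<omega>. exp (t * Y \<omega>))"
    and indep: "indep_vars (\<lambda>_. borel) Ys {1..}"
    and distr: "\<And>j. j \<ge> 1 \<Longrightarrow> distr M borel (Ys j) = distr M borel Y"
    and F: "mgf M Y has_fps_expansion F"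
  shows "(\<integral>\<omega>. (\<Sum>j=1..m. Ys j \<omega>) ^ n \<partial>M) = fact n * fps_nth (F ^ m) n"
proof -
  define S where "S = (\<lambda>\<omega>. \<Sum>j=1..m. Ys j \<omega>)"
  have "Ys j \<in> borel_measurable M" if "j \<ge> 1" for j
    using indep that unfolding indep_vars_def2 by auto
  then have "S \<in> borel_measurable M"
    unfolding S_def by (intro borel_measurable_sum) auto
  then have S: "mgf M S has_fps_expansion Abs_fps (\<lambda>n. (\<integral>\<omega>. S \<omega> ^ n \<partial>M) / fact n)"
    using \<open>\<rho> > 0\<close>
  proof (rule mgf_has_fps_expansion)
    fix t :: real assume "\<bar>t\<bar> < \<rho>"
    then show "integrable M (\<lambda>\<omega>. exp (t * S \<omega>))"
      unfolding S_def by (intro mgf_sum_iid(1)[OF Y indep distr int])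
  qed
  have "(\<lambda>t. mgf M Y t ^ m) has_fps_expansion F ^ m"
    using F by (rule has_fps_expansion_pow)
  moreover have "\<forall>\<^sub>F t in nhds (0::real). \<bar>t\<bar> < \<rho>"
    using eventually_nhds_in_open[of "ball 0 \<rho>" "0::real"] \<open>\<rho> > 0\<close> by simp
  then have "\<forall>\<^sub>F t in nhds 0. mgf M S t = mgf M Y t ^ m"
    by (rule eventually_mono) (unfold S_def, intro mgf_sum_iid(2)[OF Y indep distr int])
  ultimately have "mgf M S has_fps_expansion F ^ m"
    unfolding has_fps_expansion_def by (auto elim: eventually_elim2)
  from has_fps_expansion_real_unique[OF S this]
  have "fps_nth (F ^ m) n = (\<integral>\<omega>. S \<omega> ^ n \<partial>M) / fact n"
    by (metis fps_nth_Abs_fps)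
  then show ?thesis
    by (simp add: S_def)
qed

text \<open>
  The range of summation does not depend on \<open>m\<close>, because \<open>H ^ k\<close> has no terms of degree below
  \<open>k\<close>.  This is what reduces the series over \<open>m\<close> to finitely many series with binomial weights.
\<close>

lemma fps_power_one_plus_nth:
  fixes H :: "'a::idom fps"
  assumes "fps_nth H 0 = 0"
  shows "fps_nth ((1 + H) ^ m) n = (\<Sum>k=0..n. of_nat (m choose k) * fps_nth (H ^ k) n)"
proof -
  have zero: "fps_nth (H ^ k) n = 0" if "n < k" for k
    using startsby_zero_power_prefix[OF assms] that by blast
  have "(1 + H) ^ m = (\<Sum>k\<le>m. of_nat (m choose k) * H ^ k)"
    using binomial_ring[of H 1 m] by (simp add: add.commute)
  then have "fps_nth ((1 + H) ^ m) n = (\<Sum>k\<le>m. of_nat (m choose k) * fps_nth (H ^ k) n)"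
    by (simp add: fps_sum_nth fps_of_nat[symmetric] del: fps_of_nat)
  also have "\<dots> = (\<Sum>k\<le>max m n. of_nat (m choose k) * fps_nth (H ^ k) n)"
    by (rule sum.mono_neutral_left) (auto simp: binomial_eq_0)
  also have "\<dots> = (\<Sum>k=0..n. of_nat (m choose k) * fps_nth (H ^ k) n)"
    by (rule sum.mono_neutral_right) (auto simp: zero)
  finally show ?thesis .
qed

section \<open>The signed derangement polynomials\<close>

text \<open>
  The power series \<open>e^(y u) / (1 + u)\<close>; it arises from the generating function
  \<open>e^((x - 1) t) / (1 - t)\<close> of the derangement polynomials by \<open>t = - u\<close> and \<open>y = 1 - x\<close>.
\<close>

definition signed_derangement_fps :: "real \<Rightarrow> real fps" where
  "signed_derangement_fps y = fps_exp y * inverse (1 + fps_X)"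

lemma signed_derangement_fps_0: "fps_nth (signed_derangement_fps y) 0 = 1"
  by (simp add: signed_derangement_fps_def)

lemma signed_derangement_fps_Suc:
  "fps_nth (signed_derangement_fps y) (Suc m) + fps_nth (signed_derangement_fps y) m
     = y ^ Suc m / fact (Suc m)"
proof -
  have "inverse (1 + fps_X :: real fps) * (1 + fps_X) = 1"
    by (rule inverse_mult_eq_1) simp
  then have "signed_derangement_fps y * (1 + fps_X) = fps_exp y"
    by (simp add: signed_derangement_fps_def mult.assoc)
  from arg_cong[OF this, of "\<lambda>f. fps_nth f (Suc m)"] show ?thesis
    by (simp add: distrib_left del: fact_Suc power_Suc)
qed

text \<open>
  Both generating functions have a linear denominator, so both coefficient sequences satisfy a
  first-order recurrence, and the sign \<open>(- 1) ^ m\<close> exchanges the two recurrences.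
\<close>

lemma derangement_poly_eq:
  "derangement_poly m x / fact m * (- 1) ^ m = fps_nth (signed_derangement_fps (1 - x)) m"
proof -
  define D :: "real fps" where "D = fps_exp x / (1 - fps_X) * fps_exp (- 1)"
  have "(\<lambda>t. exp (x * t) / (1 - t) * exp (- 1 * t)) has_fps_expansion D"
    unfolding D_def
    by (intro has_fps_expansion_mult has_fps_expansion_divide' has_fps_expansion_diff
        has_fps_expansion_exp has_fps_expansion_1 has_fps_expansion_fps_X) simp
  then have D: "derangement_poly n x / fact n = fps_nth D n" for n
    by (simp add: derangement_poly_def egf_coeff_eq)
  have "inverse (1 - fps_X :: real fps) * (1 - fps_X) = 1"
    by (rule inverse_mult_eq_1) simp
  moreover have "fps_exp x * fps_exp (-1) = fps_exp (x - 1)"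
    using fps_exp_add_mult[of x "-1"] by simp
  moreover have "D = fps_exp x * fps_exp (-1) * inverse (1 - fps_X)"
    by (simp add: D_def fps_divide_unit mult_ac)
  ultimately have rec: "D * (1 - fps_X) = fps_exp (x - 1)"
    by (simp add: mult.assoc)
  have D_Suc: "fps_nth D (Suc n) = fps_nth D n + (x - 1) ^ Suc n / fact (Suc n)" for n
    using arg_cong[OF rec, of "\<lambda>f. fps_nth f (Suc n)"] by (simp add: right_diff_distrib del: fact_Suc power_Suc)
  have D_0: "fps_nth D 0 = 1"
    by (simp add: D_def fps_divide_unit)
  have "fps_nth D m * (- 1) ^ m = fps_nth (signed_derangement_fps (1 - x)) m"
  proof (induction m)
    case 0
    then show ?case by (simp add: D_0 signed_derangement_fps_0)
  next
    case (Suc m)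
    have "(x - 1) ^ Suc m * (-1) ^ Suc m = (1 - x) ^ Suc m"
      by (subst power_mult_distrib[symmetric]) simp
    then have "fps_nth D (Suc m) * (- 1) ^ Suc m =
        - (fps_nth D m * (- 1) ^ m) + (1 - x) ^ Suc m / fact (Suc m)"
      unfolding D_Suc distrib_right times_divide_eq_left by simp
    then show ?case
      using Suc.IH signed_derangement_fps_Suc[of "1 - x" m] by linarith
  qed
  then show ?thesis by (simp add: D)
qed

text \<open>
  Unrolling the recurrence bounds the coefficients by partial sums of the exponential series.
\<close>

lemma abs_signed_derangement_le:
  "\<bar>fps_nth (signed_derangement_fps y) m\<bar> \<le> exp \<bar>y\<bar>"
proof -
  have "\<bar>fps_nth (signed_derangement_fps y) m\<bar> \<le> (\<Sum>i\<le>m. \<bar>y\<bar> ^ i / fact i)"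
  proof (induction m)
    case 0
    then show ?case by (simp add: signed_derangement_fps_0)
  next
    case (Suc m)
    have "\<bar>y ^ Suc m / fact (Suc m)\<bar> = \<bar>y\<bar> ^ Suc m / fact (Suc m)"
      by (simp add: abs_mult power_abs)
    then show ?case
      using Suc.IH signed_derangement_fps_Suc[of y m] unfolding sum.atMost_Suc by linarith
  qed
  also have "\<dots> \<le> exp \<bar>y\<bar>"
    unfolding exp_def using summable_exp[of "\<bar>y\<bar>"]
    by (intro sum_le_suminf[THEN order_trans])
       (auto simp: scaleR_conv_of_real field_simps)
  finally show ?thesis .
qed

section \<open>Abel sums with binomial weights\<close>

text \<open>
  A single term of the binomial theorem gives \<open>(m choose k) * u ^ k \<le> (1 + u) ^ m\<close> for every
  \<open>u > 0\<close>, so a geometric series with ratio \<open>(1 + u) * r\<close> dominates.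
\<close>

lemma summable_binomial_weighted:
  fixes c :: "nat \<Rightarrow> real"
  assumes c: "\<And>m. \<bar>c m\<bar> \<le> B" and r: "0 < r" "r < 1"
  shows "summable (\<lambda>m. c m * real (m choose k) * r ^ m)"
proof -
  \<comment> \<open>The choice of \<open>u\<close> puts \<open>(1 + u) * r\<close> halfway between \<open>r\<close> and \<open>1\<close>.\<close>
  define u where "u = (1 - r) / (2 * r)"
  have u: "u > 0" and ur: "(1 + u) * r = (1 + r) / 2"
    using r by (auto simp: u_def field_simps)
  have "B \<ge> 0" using c[of 0] by linarith
  have choose: "real (m choose k) \<le> (1 + u) ^ m / u ^ k" for m
  proof (cases "k \<le> m")
    case True
    have "real (m choose k) * u ^ k \<le> (\<Sum>i\<le>m. real (m choose i) * u ^ i)"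
      using True u by (intro member_le_sum[of k "{..m}" "\<lambda>i. real (m choose i) * u ^ i"]) auto
    also have "\<dots> = (1 + u) ^ m"
      using binomial_ring[of u 1 m] by (simp add: add.commute)
    finally show ?thesis using u by (simp add: field_simps)
  qed (use u in \<open>auto simp: binomial_eq_0\<close>)
  have "norm (c m * real (m choose k) * r ^ m) \<le> B / u ^ k * ((1 + r) / 2) ^ m" for m
  proof -
    have "norm (c m * real (m choose k) * r ^ m) = \<bar>c m\<bar> * (real (m choose k) * r ^ m)"
      using r by (simp add: abs_mult)
    also have "\<dots> \<le> B * ((1 + u) ^ m / u ^ k * r ^ m)"
      using c choose r u \<open>B \<ge> 0\<close> by (intro mult_mono) auto
    also have "\<dots> = B / u ^ k * ((1 + r) / 2) ^ m"
      unfolding ur[symmetric] by (simp add: power_mult_distrib)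
    finally show ?thesis .
  qed
  moreover have "summable (\<lambda>m. B / u ^ k * ((1 + r) / 2) ^ m)"
    using r by (intro summable_mult summable_geometric) auto
  ultimately show ?thesis
    by (intro summable_comparison_test[OF _ \<open>summable (\<lambda>m. B / u ^ k * ((1 + r) / 2) ^ m)\<close>]) blast
qed

text \<open>
  The terms with \<open>m < k\<close> vanish, and \<open>(j + k choose k) / (j + k)! = 1 / (j! k!)\<close> leaves an
  exponential series in \<open>j = m - k\<close>.
\<close>

lemma exp_binomial_sums:
  fixes y r :: real
  shows "(\<lambda>m. y ^ m / fact m * real (m choose k) * r ^ m) sums ((y * r) ^ k / fact k * exp (y * r))"
proof -
  have "(\<lambda>j. (y * r) ^ k / fact k * ((y * r) ^ j /\<^sub>R fact j)) sums ((y * r) ^ k / fact k * exp (y * r))"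
    by (intro sums_mult exp_converges)
  moreover have "y ^ (j + k) / fact (j + k) * real ((j + k) choose k) * r ^ (j + k)
      = (y * r) ^ k / fact k * ((y * r) ^ j /\<^sub>R fact j)" for j
    using binomial_fact[of k "j + k", where 'a = real]
    by (simp add: power_add power_mult_distrib field_simps)
  ultimately have "(\<lambda>j. y ^ (j + k) / fact (j + k) * real ((j + k) choose k) * r ^ (j + k)) sums
      ((y * r) ^ k / fact k * exp (y * r))"
    by simp
  then show ?thesis
    by (subst (asm) sums_zero_iff_shift) auto
qed

text \<open>
  Multiply the recurrence of the coefficients by \<open>(m + 1 choose k) * r ^ (m + 1)\<close> and sum over
  \<open>m\<close>.  For \<open>k \<ge> 1\<close>, Pascal's rule turns the shifted series into \<open>r * (P k + P (k - 1))\<close>, so the series with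
  binomial weights satisfy a linear recurrence in \<open>k\<close> whose leading factor \<open>1 + r\<close> stays away
  from \<open>0\<close> as \<open>r\<close> tends to \<open>1\<close>.
\<close>

lemma signed_derangement_binomial_series:
  fixes y r :: real
  assumes r: "0 < r" "r < 1"
  defines "P \<equiv> \<lambda>k. \<Sum>m. fps_nth (signed_derangement_fps y) m * real (m choose k) * r ^ m"
  shows "(1 + r) * P 0 = exp (y * r)"
    and "(1 + r) * P (Suc k) + r * P k = (y * r) ^ Suc k / fact (Suc k) * exp (y * r)"
proof -
  let ?c = "fps_nth (signed_derangement_fps y)"
  have P: "(\<lambda>m. ?c m * real (m choose k) * r ^ m) sums P k" for k
    unfolding P_def
    by (intro summable_sums summable_binomial_weighted[OF abs_signed_derangement_le r])
  \<comment> \<open>The recurrence starts at index \<open>1\<close>; the terms of index \<open>0\<close>, both equal to \<open>0 choose k\<close>, cancel.\<close>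
  have tail: "(\<lambda>m. ?c (Suc m) * real (Suc m choose k) * r ^ Suc m) sums (P k - real (0 choose k))" for k
    using sums_Suc_iff[of "\<lambda>m. ?c m * real (m choose k) * r ^ m"] P[of k]
    by (simp add: signed_derangement_fps_0)
  have exp_tail: "(\<lambda>m. y ^ Suc m / fact (Suc m) * real (Suc m choose k) * r ^ Suc m) sums
      ((y * r) ^ k / fact k * exp (y * r) - real (0 choose k))" for k
    using sums_Suc_iff[of "\<lambda>m. y ^ m / fact m * real (m choose k) * r ^ m"]
      exp_binomial_sums[of y k r] by simp
  have sum_tail: "(\<lambda>m. y ^ Suc m / fact (Suc m) * real (Suc m choose k) * r ^ Suc m) sums
      (P k - real (0 choose k) + s)"
    if s: "(\<lambda>m. ?c m * real (Suc m choose k) * r ^ Suc m) sums s" for k s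
  proof -
    have "?c (Suc m) * real (Suc m choose k) * r ^ Suc m + ?c m * real (Suc m choose k) * r ^ Suc m
        = y ^ Suc m / fact (Suc m) * real (Suc m choose k) * r ^ Suc m" for m
      unfolding signed_derangement_fps_Suc[symmetric] by (simp only: distrib_right)
    with sums_add[OF tail[of k] s] show ?thesis by (simp only:)
  qed
  have rec: "P k + s = (y * r) ^ k / fact k * exp (y * r)"
    if "(\<lambda>m. ?c m * real (Suc m choose k) * r ^ Suc m) sums s" for k s
    using sums_unique2[OF sum_tail[OF that] exp_tail[of k]] by simp
  have "(\<lambda>m. ?c m * real (Suc m choose 0) * r ^ Suc m) sums (r * P 0)"
    using sums_mult[OF P[of 0], of r] by (simp add: mult_ac)
  from rec[OF this] show "(1 + r) * P 0 = exp (y * r)"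
    by (simp add: algebra_simps)
  have "(\<lambda>m. ?c m * real (Suc m choose Suc k) * r ^ Suc m) sums (r * (P k + P (Suc k)))"
    using sums_mult[OF sums_add[OF P[of k] P[of "Suc k"]], of r] by (simp add: algebra_simps)
  from rec[OF this]
  show "(1 + r) * P (Suc k) + r * P k = (y * r) ^ Suc k / fact (Suc k) * exp (y * r)"
    by (simp add: algebra_simps)
qed

text \<open>
  The expansion of \<open>e^(y u) / (1 + u)\<close> around \<open>1\<close>, that is \<open>e^(y (1 + u)) / (2 + u)\<close> as a power
  series in \<open>u\<close>.
\<close>

definition binomial_limit_fps :: "real \<Rightarrow> real fps" where
  "binomial_limit_fps y = fps_const (exp y) * (fps_exp y * inverse (2 + fps_X))"

lemma binomial_limit_fps_rec:
  "2 * fps_nth (binomial_limit_fps y) 0 = exp y"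
  "2 * fps_nth (binomial_limit_fps y) (Suc k) + fps_nth (binomial_limit_fps y) k
     = y ^ Suc k / fact (Suc k) * exp y"
proof -
  have "inverse (2 + fps_X :: real fps) * (2 + fps_X) = 1"
    by (rule inverse_mult_eq_1) simp
  then have eq: "binomial_limit_fps y * (2 + fps_X) = fps_const (exp y) * fps_exp y"
    by (simp add: binomial_limit_fps_def mult.assoc)
  show "2 * fps_nth (binomial_limit_fps y) 0 = exp y"
    using arg_cong[OF eq, of "\<lambda>f. fps_nth f 0"] by (simp add: mult.commute)
  show "2 * fps_nth (binomial_limit_fps y) (Suc k) + fps_nth (binomial_limit_fps y) k
     = y ^ Suc k / fact (Suc k) * exp y"
    using arg_cong[OF eq, of "\<lambda>f. fps_nth f (Suc k)"]
    by (simp add: distrib_left numeral_fps_const mult.commute)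
qed

text \<open>
  For \<open>r = 1\<close> the recurrence in \<open>k\<close> is the one that clearing the denominator \<open>2 + u\<close> gives for
  the coefficients of the limit series.  Solving the recurrence for its leading term carries the
  limit from \<open>k\<close> to \<open>k + 1\<close>.
\<close>

lemma signed_derangement_binomial_abel_limit:
  "((\<lambda>r. \<Sum>m. fps_nth (signed_derangement_fps y) m * real (m choose k) * r ^ m)
      \<longlongrightarrow> fps_nth (binomial_limit_fps y) k) (at_left 1)"
proof (induction k)
  case 0
  have "((\<lambda>r. exp (y * r) / (1 + r)) \<longlongrightarrow> exp (y * 1) / (1 + 1)) (at_left 1)"
    by (intro tendsto_intros) auto
  also have "exp (y * 1) / (1 + 1) = fps_nth (binomial_limit_fps y) 0"
    using binomial_limit_fps_rec(1)[of y] by simp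
  finally show ?case
  proof (rule Lim_transform_eventually)
    have "\<forall>\<^sub>F r in at_left (1::real). r \<in> {0<..<1}"
      by (rule eventually_at_left_real) simp
    then show "\<forall>\<^sub>F r in at_left 1. exp (y * r) / (1 + r) =
        (\<Sum>m. fps_nth (signed_derangement_fps y) m * real (m choose 0) * r ^ m)"
    proof eventually_elim
      case (elim r)
      then show ?case
        using signed_derangement_binomial_series(1)[of r y] by (auto simp: field_simps)
    qed
  qed
next
  case (Suc k)
  let ?P = "\<lambda>k r. \<Sum>m. fps_nth (signed_derangement_fps y) m * real (m choose k) * r ^ m"
  let ?E = "\<lambda>r. (y * r) ^ Suc k / fact (Suc k) * exp (y * r)"
  have E: "(?E \<longlongrightarrow> ?E 1) (at_left 1)"
    by (intro tendsto_mult tendsto_divide tendsto_power tendsto_exp tendsto_const tendsto_ident_at)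
      (rule fact_nonzero)
  have "((\<lambda>r. 1 + r) \<longlongrightarrow> 1 + 1) (at_left (1::real))"
    by (intro tendsto_add tendsto_const tendsto_ident_at)
  from tendsto_divide[OF tendsto_diff[OF E tendsto_mult[OF tendsto_ident_at Suc.IH]] this]
  have "((\<lambda>r. (?E r - r * ?P k r) / (1 + r))
      \<longlongrightarrow> (?E 1 - 1 * fps_nth (binomial_limit_fps y) k) / (1 + 1)) (at_left 1)"
    by (simp del: fact_Suc power_Suc)
  also have "(?E 1 - 1 * fps_nth (binomial_limit_fps y) k) / (1 + 1)
      = fps_nth (binomial_limit_fps y) (Suc k)"
    using binomial_limit_fps_rec(2)[of y k] by (simp del: fact_Suc power_Suc)
  finally show ?case
  proof (rule Lim_transform_eventually)
    have "\<forall>\<^sub>F r in at_left (1::real). r \<in> {0<..<1}"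
      by (rule eventually_at_left_real) simp
    then show "\<forall>\<^sub>F r in at_left 1. (?E r - r * ?P k r) / (1 + r) = ?P (Suc k) r"
    proof eventually_elim
      case (elim r)
      then have r: "0 < r" "r < 1" by auto
      have "(e - r * p) / (1 + r) = q" if "(1 + r) * q + r * p = e" for e p q
        using that r by (simp add: divide_eq_eq algebra_simps)
      from this[OF signed_derangement_binomial_series(2)[OF r]] show ?case .
    qed
  qed
qed

lemma signed_derangement_abel_sums:
  fixes a :: "nat \<Rightarrow> real"
  shows "(\<lambda>m. fps_nth (signed_derangement_fps y) m * (\<Sum>k=0..n. real (m choose k) * a k))
    abel_sums (\<Sum>k=0..n. fps_nth (binomial_limit_fps y) k * a k)"
proof -
  let ?c = "fps_nth (signed_derangement_fps y)"
  let ?P = "\<lambda>k r. \<Sum>m. ?c m * real (m choose k) * r ^ m"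
  have sums: "(\<lambda>m. ?c m * (\<Sum>k=0..n. real (m choose k) * a k) * r ^ m) sums
      (\<Sum>k=0..n. ?P k r * a k)" if r: "0 < r" "r < 1" for r
  proof -
    have "(\<lambda>m. \<Sum>k=0..n. ?c m * real (m choose k) * r ^ m * a k) sums (\<Sum>k=0..n. ?P k r * a k)"
      by (intro sums_sum sums_mult2 summable_sums
          summable_binomial_weighted[OF abs_signed_derangement_le r])
    then show ?thesis
      by (simp add: sum_distrib_left sum_distrib_right mult_ac)
  qed
  have "((\<lambda>r. \<Sum>k=0..n. ?P k r * a k) \<longlongrightarrow> (\<Sum>k=0..n. fps_nth (binomial_limit_fps y) k * a k))
      (at_left 1)"
    by (intro tendsto_sum tendsto_mult_right signed_derangement_binomial_abel_limit)
  moreover have "\<forall>\<^sub>F r in at_left (1::real). r \<in> {0<..<1}"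
    by (rule eventually_at_left_real) simp
  then have "\<forall>\<^sub>F r in at_left 1. (\<Sum>k=0..n. ?P k r * a k)
      = (\<Sum>m. ?c m * (\<Sum>k=0..n. real (m choose k) * a k) * r ^ m)"
    by (rule eventually_mono) (use sums in \<open>auto simp: sums_iff\<close>)
  ultimately have "((\<lambda>r. \<Sum>m. ?c m * (\<Sum>k=0..n. real (m choose k) * a k) * r ^ m)
      \<longlongrightarrow> (\<Sum>k=0..n. fps_nth (binomial_limit_fps y) k * a k)) (at_left 1)"
    by (rule Lim_transform_eventually)
  then show ?thesis
    unfolding abel_sums_def using sums by (auto simp: sums_iff)
qed

section \<open>The binomial convolution of Bell polynomials and Euler numbers\<close>

lemma prob_bell_eq:
  assumes "mgf M Y has_fps_expansion 1 + H"
  shows "prob_bell M Y n y = fact n * fps_nth (fps_exp y oo H) n"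
proof -
  have "(\<lambda>t. mgf M Y t - 1) has_fps_expansion 1 + H - 1"
    by (intro has_fps_expansion_diff assms has_fps_expansion_1)
  then have "(\<lambda>t. 1 / fact k * (mgf M Y t - 1) ^ k) has_fps_expansion fps_const (1 / fact k) * H ^ k" for k
    by (intro has_fps_expansion_cmult_left has_fps_expansion_pow) simp
  then have "prob_stirling2 M Y n k = fact n * (1 / fact k * fps_nth (H ^ k) n)" for k
    unfolding prob_stirling2_def by (subst egf_coeff_eq) auto
  then show ?thesis
    by (simp add: prob_bell_def fps_compose_nth sum_distrib_left mult_ac)
qed

lemma prob_euler_eq:
  assumes "mgf M Y has_fps_expansion 1 + H" and H: "fps_nth H 0 = 0"
  shows "prob_euler M Y n = fact n * fps_nth (fps_const 2 * (inverse (2 + fps_X) oo H)) n"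
proof -
  have "inverse (2 + fps_X :: real fps) oo H = inverse ((2 + fps_X) oo H)"
    by (rule fps_inverse_compose) (auto simp: H)
  also have "(2 + fps_X) oo H = 2 + H"
    by (simp add: fps_compose_add_distrib H)
  finally have inv: "inverse (2 + fps_X :: real fps) oo H = inverse (2 + H)" .
  have "(\<lambda>t. mgf M Y t + 1) has_fps_expansion 1 + H + 1"
    by (intro has_fps_expansion_add assms has_fps_expansion_1)
  also have "1 + H + 1 = 2 + H" by simp
  finally have "(\<lambda>t. 2 * inverse (mgf M Y t + 1)) has_fps_expansion fps_const 2 * inverse (2 + H)"
    by (intro has_fps_expansion_cmult_left has_fps_expansion_inverse) (auto simp: H)
  then show ?thesis
    unfolding prob_euler_def inv divide_inverse by (rule egf_coeff_eq)
qed

lemma binomial_convolution_egf: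
  fixes A B :: "real fps"
  shows "(\<Sum>m=0..n. real (n choose m) * (fact m * fps_nth A m) * (fact (n - m) * fps_nth B (n - m)))
    = fact n * fps_nth (A * B) n"
  unfolding fps_mult_nth sum_distrib_left
proof (rule sum.cong)
  fix m assume "m \<in> {0..n}"
  then have "fact m * fact (n - m) * real (n choose m) = fact n"
    using binomial_fact_lemma[of m n] by (metis atLeastAtMost_iff of_nat_fact of_nat_mult)
  then show "real (n choose m) * (fact m * fps_nth A m) * (fact (n - m) * fps_nth B (n - m))
      = fact n * (fps_nth A m * fps_nth B (n - m))"
    by (metis (no_types, opaque_lifting) mult.commute mult.left_commute)
qed simp

text \<open>
  Composition with \<open>H\<close> is multiplicative, so the product of the two generating functions is
  \<open>2 e^(y u) / (2 + u)\<close> composed with \<open>H\<close>; the factor \<open>exp (- y)\<close> compensates for the \<open>e^y\<close> in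
  the limit series.
\<close>

lemma bell_euler_convolution:
  assumes F: "mgf M Y has_fps_expansion 1 + H" and H: "fps_nth H 0 = 0"
  shows "(\<Sum>m=0..n. real (n choose m) * prob_bell M Y m y * prob_euler M Y (n - m))
    = 2 * exp (- y) * (fact n * fps_nth (binomial_limit_fps y oo H) n)"
proof -
  have "binomial_limit_fps y oo H
      = fps_const (exp y) * ((fps_exp y oo H) * (inverse (2 + fps_X) oo H))"
    unfolding binomial_limit_fps_def by (simp add: fps_compose_mult_distrib[OF H])
  then have "fps_nth ((fps_exp y oo H) * (fps_const 2 * (inverse (2 + fps_X) oo H))) n
      = 2 * exp (- y) * fps_nth (binomial_limit_fps y oo H) n"
    by (simp add: exp_minus mult.left_commute[of _ "fps_const 2"])
  then show ?thesis
    unfolding prob_bell_eq[OF F] prob_euler_eq[OF F H] binomial_convolution_egf by simp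
qed

theorem theorem2p4:
  fixes M :: "'a measure" and Y :: "'a \<Rightarrow> real" and Ys :: "nat \<Rightarrow> 'a \<Rightarrow> real"
    and \<rho> x :: real and n :: nat
  assumes "prob_space M"
    and "Y \<in> borel_measurable M"
    and "\<rho> > 0"
    and "\<And>t. \<bar>t\<bar> < \<rho> \<Longrightarrow> integrable M (\<lambda>\<omega>. exp (t * Y \<omega>))"
    and "prob_space.indep_vars M (\<lambda>_. borel) Ys {1..}"
    and "\<And>j. j \<ge> 1 \<Longrightarrow> distr M borel (Ys j) = distr M borel Y"
  shows "\<exists>A. (\<lambda>m. derangement_poly m x / fact m * (- 1) ^ m *
                (\<integral>\<omega>. (\<Sum>j=1..m. Ys j \<omega>) ^ n \<partial>M)) abel_sums A \<and>
             (\<Sum>m=0..n. real (n choose m) * prob_bell M Y m (1 - x) * prob_euler M Y (n - m))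
               = 2 * exp (x - 1) * A"
proof -
  interpret prob_space M by fact
  define F where "F = Abs_fps (\<lambda>n. (\<integral>\<omega>. Y \<omega> ^ n \<partial>M) / fact n)"
  define H where "H = F - 1"
  have F: "mgf M Y has_fps_expansion F"
    unfolding F_def using assms(2-4) by (rule mgf_has_fps_expansion)
  have H0: "fps_nth H 0 = 0"
    by (simp add: H_def F_def prob_space)
  have F_eq: "F = 1 + H" by (simp add: H_def)
  define a where "a = (\<lambda>k. fact n * fps_nth (H ^ k) n)"
  define A where "A = (\<Sum>k=0..n. fps_nth (binomial_limit_fps (1 - x)) k * a k)"
  have moments: "(\<integral>\<omega>. (\<Sum>j=1..m. Ys j \<omega>) ^ n \<partial>M) = (\<Sum>k=0..n. real (m choose k) * a k)" for m
  proof -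
    have "(\<integral>\<omega>. (\<Sum>j=1..m. Ys j \<omega>) ^ n \<partial>M) = fact n * fps_nth (F ^ m) n"
      using assms(2-6) F by (rule moment_sum_iid)
    then show ?thesis
      unfolding F_eq fps_power_one_plus_nth[OF H0] a_def by (simp add: sum_distrib_left mult_ac)
  qed
  have "(\<lambda>m. derangement_poly m x / fact m * (- 1) ^ m *
      (\<integral>\<omega>. (\<Sum>j=1..m. Ys j \<omega>) ^ n \<partial>M)) abel_sums A"
    unfolding derangement_poly_eq moments A_def by (rule signed_derangement_abel_sums)
  moreover have "A = fact n * fps_nth (binomial_limit_fps (1 - x) oo H) n"
    by (simp add: A_def a_def fps_compose_nth sum_distrib_left mult_ac)
  ultimately show ?thesis
    using bell_euler_convolution[OF F[unfolded F_eq] H0, of n "1 - x"] by auto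
qed

end
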